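(* Let $B=B(F_n)$ be a generalized Bratteli diagram having the equal row sums property with parameters $(r_n)_{n\ge0}$, i.e. $\sum_{w\in V_n}f^{(n)}_{v,w}=r_n$ for all $n\in\mathbb N_0$ and all $v\in V_{n+1}$. Let $\overline B=B(W_n)$ be a vertex subdiagram of $B$ with finite sets $W_n\subset V_n$ that is a simple standard Bratteli diagram, and let $\nu$ be a probability tail invariant measure on $X_{\overline B}$. If the extension of $\nu$ to $\widehat X_{\overline B}$ is finite and the set $\{m'_n/M'_n:n\in\mathbb N\}$ is bounded from below by a positive constant $\delta$, then the limit $$\lim_{n\to\infty}\prod_{i=0}^n\frac{r_i}{\overline M_i|W_i|}$$ exists.
   Context: A generalized Bratteli diagram is a graded graph $B=(V,E)$, $V=\bigsqcup_{n\ge0}V_n$, $E=\bigsqcup_{n\ge0}E_n$, with each $V_n$ countably infinite and each $E_n$ countable; every $e\in E_n$ has a source $s(e)\in V_n$ and a range $r(e)\in V_{n+1}$; $s^{-1}(v)\ne\emptyset$ for all $v\in V$; $r^{-1}(v)$ is nonempty and finite for all $v\in V\setminus V_0$. If instead every $V_n$ is finite, the diagram is called standard. The incidence matrix $F_n=(f^{(n)}_{v,w})_{v\in V_{n+1},w\in V_n}$ counts the edges between $w$ and $v$. The path space $X_B$ is the set of infinite sequences $(x_n)$, $x_n\in E_n$, $r(x_n)=s(x_{n+1})$, with the topology generated by cylinder sets of finite paths starting in $V_0$. Two paths are tail equivalent (relation $\mathcal R$) if they agree from some index on. A tail invariant measure is a non-atomic positive Borel measure giving equal value to cylinder sets $[\overline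 e]$, $[\overline e']$ whenever $\overline e,\overline e'$ are finite paths from $V_0$ to the same vertex. Vertex subdiagram $B(W_n)$: vertex sets $W_n\subsetneq V_n$ and all edges of $B$ with source in $W_n$ and range in $W_{n+1}$. Simplicity of $\overline B$ is used in the form (after telescoping): $f^{(n)}_{v,w}>0$ for all $w\in W_n$, $v\in W_{n+1}$, $n\in\mathbb N_0$. Notation: $\overline M_n=\max\{f^{(n)}_{v,w}:v\in W_{n+1},w\in W_n\}$. $W'_n$ denotes the finite set of vertices $w\in V_n\setminus W_n$ with $f^{(n)}_{v,w}>0$ for some $v\in W_{n+1}$; $M'_n=\max\{f^{(n)}_{v,w}:v\in W_{n+1},w\in W'_n\}$ and $m'_n=\min\{f^{(n)}_{v,w}:v\in W_{n+1},w\in W'_n\}$; the ratios are understood to be defined, i.e. $W'_n\neq\emptyset$. Measure extension: $\widehat X_{\overline B}\subset X_B$ is the set of all paths of $X_B$ tail equivalent (in $B$) to some path of $X_{\overline B}$; $\widehat\nu$ is the unique $\mathcal R$-invariant Borel measure (possibly infinite) on $\widehat X_{\overline B}$ extending $\nu$: for a finite path $f$ of $B$ from $V_0$ to $v\in W_n$, the set of paths that begin with $f$ and whose edges after $f$ all lie in $\overline B$ has $\widehat\nu$-measure equal to the $\nu$-measure of a cylinder set of $X_{\overline B}$ ending at $v$. The extension is finite if $\widehat\nu(\widehat X_{\overline B})<\infty$. *)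

theory Defs
  imports "HOL-Probability.Probability"
begin

record ('v, 'e) bratteli =
  Vert :: "nat \<Rightarrow> 'v set"
  Edge :: "nat \<Rightarrow> 'e set"
  src :: "'e \<Rightarrow> 'v"
  rng :: "'e \<Rightarrow> 'v"

definition graded_diagram :: "('v, 'e) bratteli \<Rightarrow> bool" where
  "graded_diagram B \<longleftrightarrow>
     disjoint_family (Vert B) \<and> disjoint_family (Edge B) \<and>
     (\<forall>n. countable (Edge B n)) \<and>
     (\<forall>n. \<forall>e\<in>Edge B n. src B e \<in> Vert B n \<and> rng B e \<in> Vert B (Suc n)) \<and>
     (\<forall>n. \<forall>v\<in>Vert B n. {e \<in> Edge B n. src B e = v} \<noteq> {}) \<and>
     (\<forall>n. \<forall>v\<in>Vert B (Suc n).
        {e \<in> Edge B n. rng B e = v} \<noteq> {} \<and> finite {e \<in> Edge B n. rng B e = v})"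

definition generalized_bratteli :: "('v, 'e) bratteli \<Rightarrow> bool" where
  "generalized_bratteli B \<longleftrightarrow>
     graded_diagram B \<and> (\<forall>n. countable (Vert B n) \<and> infinite (Vert B n))"

definition standard_bratteli :: "('v, 'e) bratteli \<Rightarrow> bool" where
  "standard_bratteli B \<longleftrightarrow>
     graded_diagram B \<and> (\<forall>n. finite (Vert B n) \<and> Vert B n \<noteq> {})"

definition incidence :: "('v, 'e) bratteli \<Rightarrow> nat \<Rightarrow> 'v \<Rightarrow> 'v \<Rightarrow> nat" where
  "incidence B n v w = card {e \<in> Edge B n. src B e = w \<and> rng B e = v}"

text \<open>The sum ranges over the infinite set of vertices of level \<open>n\<close>, so it is expressed with
  \<open>has_sum\<close>; a finite-set sum would silently be 0.\<close>

definition equal_row_sums :: "('v, 'e) bratteli \<Rightarrow> (nat \<Rightarrow> nat) \<Rightarrow> bool" where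
  "equal_row_sums B r \<longleftrightarrow>
     (\<forall>n. \<forall>v\<in>Vert B (Suc n). ((\<lambda>w. incidence B n v w) has_sum r n) (Vert B n))"

text \<open>Simplicity is taken in its telescoped form: all incidence matrices are strictly positive.\<close>

definition simple_bratteli :: "('v, 'e) bratteli \<Rightarrow> bool" where
  "simple_bratteli B \<longleftrightarrow>
     (\<forall>n. \<forall>w\<in>Vert B n. \<forall>v\<in>Vert B (Suc n). incidence B n v w > 0)"

definition path_space :: "('v, 'e) bratteli \<Rightarrow> (nat \<Rightarrow> 'e) set" where
  "path_space B = {x. \<forall>n. x n \<in> Edge B n \<and> rng B (x n) = src B (x (Suc n))}"

text \<open>Finite paths start at level 0 and have at least one edge, so \<open>es\<close> ends at the vertex
  \<open>rng B (last es)\<close> of level \<open>length es\<close>.\<close>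

definition finite_path :: "('v, 'e) bratteli \<Rightarrow> 'e list \<Rightarrow> bool" where
  "finite_path B es \<longleftrightarrow>
     es \<noteq> [] \<and> (\<forall>i<length es. es ! i \<in> Edge B i) \<and>
     (\<forall>i. Suc i < length es \<longrightarrow> rng B (es ! i) = src B (es ! Suc i))"

definition cylinder :: "('v, 'e) bratteli \<Rightarrow> 'e list \<Rightarrow> (nat \<Rightarrow> 'e) set" where
  "cylinder B es = {x \<in> path_space B. \<forall>i<length es. x i = es ! i}"

definition path_topology :: "('v, 'e) bratteli \<Rightarrow> (nat \<Rightarrow> 'e) topology" where
  "path_topology B = topology_generated_by {cylinder B es |es. finite_path B es}"

definition borel_of :: "'a topology \<Rightarrow> 'a measure" where
  "borel_of T = sigma (topspace T) {U. openin T U}"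

definition tail_equivalent :: "(nat \<Rightarrow> 'e) \<Rightarrow> (nat \<Rightarrow> 'e) \<Rightarrow> bool" where
  "tail_equivalent x y \<longleftrightarrow> (\<exists>N. \<forall>n\<ge>N. x n = y n)"

definition non_atomic :: "'a measure \<Rightarrow> bool" where
  "non_atomic M \<longleftrightarrow>
     (\<forall>A\<in>sets M. emeasure M A > 0 \<longrightarrow>
        (\<exists>A'\<in>sets M. A' \<subseteq> A \<and> 0 < emeasure M A' \<and> emeasure M A' < emeasure M A))"

text \<open>The intersection with \<open>space M\<close> allows measures living on a subset of the path space.\<close>

definition tail_invariant :: "('v, 'e) bratteli \<Rightarrow> (nat \<Rightarrow> 'e) measure \<Rightarrow> bool" where
  "tail_invariant B M \<longleftrightarrow>
     (\<forall>es es'. finite_path B es \<and> finite_path B es' \<and> rng B (last es) = rng B (last es') \<longrightarrow>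
        emeasure M (cylinder B es \<inter> space M) = emeasure M (cylinder B es' \<inter> space M))"

definition tail_invariant_measure :: "('v, 'e) bratteli \<Rightarrow> (nat \<Rightarrow> 'e) measure \<Rightarrow> bool" where
  "tail_invariant_measure B M \<longleftrightarrow>
     sets M = sets (borel_of (path_topology B)) \<and> non_atomic M \<and> tail_invariant B M"

definition subdiagram :: "('v, 'e) bratteli \<Rightarrow> (nat \<Rightarrow> 'v set) \<Rightarrow> ('v, 'e) bratteli" where
  "subdiagram B W =
     \<lparr>Vert = W, Edge = (\<lambda>n. {e \<in> Edge B n. src B e \<in> W n \<and> rng B e \<in> W (Suc n)}),
      src = src B, rng = rng B\<rparr>"

definition hat_path_space :: "('v, 'e) bratteli \<Rightarrow> (nat \<Rightarrow> 'v set) \<Rightarrow> (nat \<Rightarrow> 'e) set" where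
  "hat_path_space B W =
     {x \<in> path_space B. \<exists>y\<in>path_space (subdiagram B W). tail_equivalent x y}"

text \<open>The last clause determines the measure: the path space of the subdiagram is moved along
  \<open>es\<close>, a finite path of \<open>B\<close> that ends at the same vertex as the path \<open>es'\<close> of the subdiagram.
  Tail invariance on cylinder sets alone would not suffice, as their measures can be infinite.\<close>

definition measure_extension ::
  "('v, 'e) bratteli \<Rightarrow> (nat \<Rightarrow> 'v set) \<Rightarrow> (nat \<Rightarrow> 'e) measure \<Rightarrow> (nat \<Rightarrow> 'e) measure \<Rightarrow> bool" where
  "measure_extension B W \<nu> \<nu>hat \<longleftrightarrow>
     sets \<nu>hat = sets (borel_of (subtopology (path_topology B) (hat_path_space B W))) \<and>
     (\<forall>A\<in>sets \<nu>. emeasure \<nu>hat A = emeasure \<nu> A) \<and>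
     tail_invariant B \<nu>hat \<and>
     (\<forall>es es'. finite_path B es \<and> finite_path (subdiagram B W) es' \<and>
        rng B (last es) = rng B (last es') \<longrightarrow>
        emeasure \<nu>hat {x \<in> cylinder B es. \<forall>n\<ge>length es. x n \<in> Edge (subdiagram B W) n}
          = emeasure \<nu> (cylinder (subdiagram B W) es'))"

definition Mbar :: "('v, 'e) bratteli \<Rightarrow> (nat \<Rightarrow> 'v set) \<Rightarrow> nat \<Rightarrow> nat" where
  "Mbar B W n = Max {incidence B n v w |v w. v \<in> W (Suc n) \<and> w \<in> W n}"

definition Wprime :: "('v, 'e) bratteli \<Rightarrow> (nat \<Rightarrow> 'v set) \<Rightarrow> nat \<Rightarrow> 'v set" where
  "Wprime B W n = {w \<in> Vert B n - W n. \<exists>v\<in>W (Suc n). incidence B n v w > 0}"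

definition Mprime :: "('v, 'e) bratteli \<Rightarrow> (nat \<Rightarrow> 'v set) \<Rightarrow> nat \<Rightarrow> nat" where
  "Mprime B W n = Max {incidence B n v w |v w. v \<in> W (Suc n) \<and> w \<in> Wprime B W n}"

definition mprime :: "('v, 'e) bratteli \<Rightarrow> (nat \<Rightarrow> 'v set) \<Rightarrow> nat \<Rightarrow> nat" where
  "mprime B W n = Min {incidence B n v w |v w. v \<in> W (Suc n) \<and> w \<in> Wprime B W n}"

end

theory Submission imports Defs begin

text \<open>
  Let \<open>p\<^sub>n(v)\<close> be the \<open>\<nu>\<close>-measure of a cylinder ending at \<open>v \<in> W\<^sub>n\<close>, let \<open>S\<^sub>n\<close> be the sum of
  \<open>p\<^sub>n\<close> over \<open>W\<^sub>n\<close>, and let \<open>R\<^sub>n = r\<^sub>0 \<cdots> r\<^bsub>n-1\<^esub>\<close>, the number of finite paths of \<open>B\<close> ending at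
  any given vertex of level \<open>n\<close>. The paths that stay in the subdiagram from level \<open>n\<close> on
  have extended measure \<open>R\<^sub>n S\<^sub>n\<close>, so these numbers are bounded. A vertex of \<open>W\<^bsub>n+1\<^esub>\<close> receives at
  least \<open>l\<^sub>n = m'\<^sub>n |W'\<^sub>n|\<close> edges from outside \<open>W\<^sub>n\<close>, whence \<open>S\<^sub>n \<le> (r\<^sub>n - l\<^sub>n) S\<^bsub>n+1\<^esub>\<close>; thus \<open>R\<^sub>n S\<^sub>n\<close>
  increases by at least \<open>R\<^bsub>n+1\<^esub> S\<^bsub>n+1\<^esub> l\<^sub>n / r\<^sub>n\<close> and \<open>\<Sum> l\<^sub>n / r\<^sub>n\<close> converges. By the assumption on
  \<open>m'\<^sub>n / M'\<^sub>n\<close> so does the sum of \<open>t\<^sub>n = M'\<^sub>n |W'\<^sub>n| / r\<^sub>n\<close>. Since the number of edges from \<open>W\<^sub>n\<close>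
  into a vertex of \<open>W\<^bsub>n+1\<^esub>\<close> is at least \<open>r\<^sub>n (1 - t\<^sub>n)\<close>, the factors of the product are at most
  \<open>1 / (1 - t\<^sub>n) \<le> 1 + 2 t\<^sub>n\<close> for large \<open>n\<close>, and a product of nonnegative factors with
  this property converges (possibly to 0).
\<close>

subsection \<open>Convergence of products\<close>

text \<open>Multiplying the partial products by \<open>exp (- (\<Sum>i\<le>n. t i))\<close> gives a
  nonnegative, eventually monotone sequence, and the exponential factor itself converges to a
  nonzero limit. Convergence of the partial products is claimed rather than
  \<open>convergent_prod\<close>, since without a lower bound on \<open>q\<close> the limit may be
  0.\<close>

lemma convergent_prod_if_eventually_le:
  fixes q t :: "nat \<Rightarrow> real"
  assumes "summable t" and "\<And>n. t n \<ge> 0" and "\<And>n. q n \<ge> 0"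
    and "eventually (\<lambda>n. q n \<le> 1 + t n) sequentially"
  shows "convergent (\<lambda>n. \<Prod>i\<le>n. q i)"
proof -
  \<comment> \<open>eventually decreasing, because \<open>1 + t \<le> exp t\<close>\<close>
  define g where "g n = (\<Prod>i\<le>n. q i) * exp (- (\<Sum>i\<le>n. t i))" for n
  obtain N where N: "\<And>n. n \<ge> N \<Longrightarrow> q n \<le> 1 + t n"
    using assms(4) by (auto simp: eventually_sequentially)
  have nonneg: "g n \<ge> 0" for n
    unfolding g_def by (intro mult_nonneg_nonneg prod_nonneg) (auto simp: assms)
  have step: "g (Suc n) \<le> g n" if "n \<ge> N" for n
  proof -
    have "q (Suc n) \<le> exp (t (Suc n))"
      using N[of "Suc n"] exp_ge_add_one_self[of "t (Suc n)"] that by linarith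
    hence "q (Suc n) * exp (- t (Suc n)) \<le> 1"
      by (simp add: exp_minus field_simps)
    hence "g n * (q (Suc n) * exp (- t (Suc n))) \<le> g n * 1"
      by (rule mult_left_mono) (rule nonneg)
    thus ?thesis
      by (simp add: g_def exp_diff exp_minus field_simps)
  qed
  have "decseq (\<lambda>n. g (n + N))"
    by (rule decseq_SucI) (simp add: step)
  hence "convergent (\<lambda>n. g (n + N))"
    using decseq_convergent[of _ 0] nonneg by (metis convergentI)
  hence "convergent g"
    by (simp add: convergent_ignore_initial_segment)
  moreover have "convergent (\<lambda>n. \<Sum>i\<le>n. t i)"
    using assms(1) by (simp add: summable_iff_convergent')
  hence "convergent (\<lambda>n. exp (\<Sum>i\<le>n. t i))"
    unfolding convergent_def by (metis tendsto_exp)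
  ultimately have "convergent (\<lambda>n. g n * exp (\<Sum>i\<le>n. t i))"
    by (rule convergent_mult)
  thus ?thesis
    by (simp add: g_def mult.assoc flip: exp_add)
qed

text \<open>The quantity \<open>a n = (\<Prod>i<n. r i) * S n\<close> grows by at least
  \<open>a (Suc n) * (l n / r n)\<close>, hence by at least \<open>a 0 * (l n / r n)\<close>;
  telescoping against its upper bound gives summability. The constant \<open>c\<close> absorbs a
  leading factor of the product that is lost when indices are shifted.\<close>

lemma summable_if_prod_mult_bounded:
  fixes r S l :: "nat \<Rightarrow> real"
  assumes r: "\<And>n. r n > 0" and l: "\<And>n. l n \<ge> 0"
    and S: "S 0 > 0" "\<And>n. S n \<ge> 0" "\<And>n. S n \<le> (r n - l n) * S (Suc n)"
    and bound: "\<And>n. c * (\<Prod>i<n. r i) * S n \<le> C" and c: "c > 0"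
  shows "summable (\<lambda>n. l n / r n)"
proof -
  define a where "a n = (\<Prod>i<n. r i) * S n" for n
  have R: "(\<Prod>i<n. r i) > 0" for n
    by (simp add: prod_pos r)
  have step: "a n \<le> a (Suc n) - a (Suc n) * (l n / r n)" for n
  proof -
    have "a n \<le> (\<Prod>i<n. r i) * ((r n - l n) * S (Suc n))"
      unfolding a_def using S(3) R[of n] by (simp add: mult_left_mono)
    \<comment> \<open>The product up to \<open>n\<close> is the product up to \<open>Suc n\<close>
      divided by \<open>r n\<close>.\<close>
    also have "\<dots> = a (Suc n) - a (Suc n) * (l n / r n)"
      using r[of n] by (simp add: a_def field_simps)
    finally show ?thesis .
  qed
  have a_nonneg: "a n \<ge> 0" for n
    unfolding a_def using R[of n] S(2)[of n] by simp
  have "a n \<le> a (Suc n)" for n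
    using step[of n] mult_nonneg_nonneg[OF a_nonneg[of "Suc n"], of "l n / r n"] l[of n] r[of n]
    by (simp add: less_imp_le)
  hence "a 0 \<le> a n" for n
    using lift_Suc_mono_le[of a 0 n] by simp
  hence "a 0 * (l n / r n) \<le> a (Suc n) - a n" for n
    using step[of n] mult_right_mono[of "a 0" "a (Suc n)" "l n / r n"] l[of n] r[of n]
    by (simp add: less_imp_le)
  hence "(\<Sum>i<n. a 0 * (l i / r i)) \<le> (\<Sum>i<n. a (Suc i) - a i)" for n
    by (intro sum_mono)
  hence sum_le: "a 0 * (\<Sum>i<n. l i / r i) \<le> a n - a 0" for n
    by (simp only: sum_lessThan_telescope sum_distrib_left)
  have "a 0 > 0"
    by (simp add: a_def S)
  have "(\<Sum>i<n. l i / r i) \<le> C / c / a 0" for n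
  proof -
    have "a n \<le> C / c"
      using bound[of n] c by (simp add: a_def pos_le_divide_eq mult_ac)
    hence "(\<Sum>i<n. l i / r i) * a 0 \<le> C / c"
      using sum_le[of n] \<open>a 0 > 0\<close> by (simp add: mult.commute)
    thus ?thesis
      using \<open>a 0 > 0\<close> by (simp only: pos_le_divide_eq)
  qed
  thus ?thesis
    using l r by (intro bounded_imp_summable[of _ "C / c / a 0"])
      (simp_all only: less_imp_le divide_nonneg_pos flip: lessThan_Suc_atMost)
qed

text \<open>The analytic content of the theorem, free of diagrams: \<open>l\<close> and
  \<open>u\<close> bound the number of edges entering from outside, \<open>K\<close> is the
  denominator of the factors. Most hypotheses start at index 1, because finite paths have at least
  one edge and the assumption on \<open>\<delta>\<close> starts there too; \<open>r\<close> and
  \<open>K\<close> must be positive at 0 as well, since the product includes that factor.\<close>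

lemma convergent_prod_ratio:
  fixes r S l u K :: "nat \<Rightarrow> real"
  assumes r: "\<And>n. r n > 0" and K: "\<And>n. K n > 0"
    and l: "\<And>n. n \<ge> 1 \<Longrightarrow> l n \<ge> 0" and u: "\<And>n. n \<ge> 1 \<Longrightarrow> u n \<ge> 0"
    and S: "S 1 > 0" "\<And>n. n \<ge> 1 \<Longrightarrow> S n \<ge> 0"
      "\<And>n. n \<ge> 1 \<Longrightarrow> S n \<le> (r n - l n) * S (Suc n)"
    and bound: "\<And>n. n \<ge> 1 \<Longrightarrow> (\<Prod>i<n. r i) * S n \<le> C"
    and ru: "\<And>n. n \<ge> 1 \<Longrightarrow> r n - u n \<le> K n"
    and "\<delta> > 0" and ul: "\<And>n. n \<ge> 1 \<Longrightarrow> \<delta> * u n \<le> l n"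
  shows "convergent (\<lambda>n. \<Prod>i\<le>n. r i / K i)"
proof -
  have "summable (\<lambda>n. l (Suc n) / r (Suc n))"
  \<comment> \<open>All sequences are shifted by one; \<open>c = r 0\<close> is the factor that the
    shifted product omits.\<close>
  proof (rule summable_if_prod_mult_bounded[where S="\<lambda>n. S (Suc n)" and C=C and c="r 0"])
    show "r 0 * (\<Prod>i<n. r (Suc i)) * S (Suc n) \<le> C" for n
      using bound[of "Suc n"] by (simp only: prod.lessThan_Suc_shift)
  qed (use assms in auto)
  hence "summable (\<lambda>n. l n / r n)"
    using summable_Suc_iff[of "\<lambda>n. l n / r n"] by simp
  hence "summable (\<lambda>n. (l n / r n) / \<delta>)"
    by (rule summable_divide)
  hence "summable (\<lambda>n. u n / r n)"
  proof (rule summable_comparison_test'[where N=1])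
    show "norm (u n / r n) \<le> l n / r n / \<delta>" if "n \<ge> 1" for n
      using ul[of n] r[of n] u[of n] that \<open>\<delta> > 0\<close> by (simp add: field_simps)
  qed
  \<comment> \<open>Nothing is known about the sign of \<open>u 0\<close>, so the term at 0 is set
    to 0.\<close>
  define t where "t n = (if n = 0 then 0 else u n / r n)" for n
  have t_nonneg: "t n \<ge> 0" for n
    using u[of n] r[of n] by (simp add: t_def less_imp_le)
  have "summable t"
    using \<open>summable (\<lambda>n. u n / r n)\<close>
    by (rule summable_comparison_test'[where N=1]) (simp add: t_def u r less_imp_le)
  show ?thesis
  proof (rule convergent_prod_if_eventually_le)
    \<comment> \<open>The factor 2 works because
      \<open>(1 - t) * (1 + 2 * t) = 1 + t * (1 - 2 * t)\<close>, which is at least 1 for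
      \<open>0 \<le> t \<le> 1 / 2\<close>.\<close>
    show "summable (\<lambda>n. 2 * t n)"
      using \<open>summable t\<close> by (rule summable_mult)
    have "eventually (\<lambda>n. t n < 1 / 2) sequentially"
      using summable_LIMSEQ_zero[OF \<open>summable t\<close>] by (rule order_tendstoD) simp
    thus "eventually (\<lambda>n. r n / K n \<le> 1 + 2 * t n) sequentially"
      using eventually_ge_at_top[of 1]
    proof eventually_elim
      case (elim n)
      have "r n * (1 - t n) \<le> K n"
        using ru[of n] r[of n] elim by (simp add: t_def right_diff_distrib)
      hence "r n * (1 - t n) * (1 + 2 * t n) \<le> K n * (1 + 2 * t n)"
        using t_nonneg[of n] by (intro mult_right_mono) auto
      moreover have "t n * t n \<le> t n * (1 / 2)"
        using t_nonneg[of n] elim by (intro mult_left_mono) auto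
      hence "1 \<le> (1 - t n) * (1 + 2 * t n)"
        by (simp add: algebra_simps)
      hence "r n * 1 \<le> r n * ((1 - t n) * (1 + 2 * t n))"
        using r[of n] by (intro mult_left_mono) auto
      ultimately have "r n \<le> K n * (1 + 2 * t n)"
        by (simp add: mult.assoc)
      thus ?case
        using K[of n] by (simp add: field_simps)
    qed
  qed (use t_nonneg r K in \<open>auto simp: less_imp_le\<close>)
qed

subsection \<open>Finite paths and cylinder sets\<close>

text \<open>Empty for \<open>n = 0\<close>, as a finite path has at least one edge; hence the
  condition \<open>n \<ge> 1\<close> in what follows.\<close>

definition paths_to :: "('v, 'e) bratteli \<Rightarrow> nat \<Rightarrow> 'v \<Rightarrow> 'e list set" where
  "paths_to B n v = {es. finite_path B es \<and> length es = n \<and> rng B (last es) = v}"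

lemma paths_to_Suc_0:
  "paths_to B (Suc 0) v = (\<lambda>e. [e]) ` {e \<in> Edge B 0. rng B e = v}"
  by (auto simp: paths_to_def finite_path_def length_Suc_conv)

lemma finite_path_snoc:
  assumes "es \<noteq> []"
  shows "finite_path B (es @ [e]) \<longleftrightarrow>
    finite_path B es \<and> e \<in> Edge B (length es) \<and> rng B (last es) = src B e"
proof -
  have "(\<forall>i<length (es @ [e]). (es @ [e]) ! i \<in> Edge B i) \<longleftrightarrow>
      (\<forall>i<length es. es ! i \<in> Edge B i) \<and> e \<in> Edge B (length es)"
    by (auto simp: nth_append less_Suc_eq)
  moreover have "(\<forall>i. Suc i < length (es @ [e]) \<longrightarrow>
        rng B ((es @ [e]) ! i) = src B ((es @ [e]) ! Suc i)) \<longleftrightarrow>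
      (\<forall>i. Suc i < length es \<longrightarrow> rng B (es ! i) = src B (es ! Suc i)) \<and>
      rng B (last es) = src B e"
  proof -
    obtain m where m: "length es = Suc m"
      using assms by (cases es) auto
    show ?thesis
      using assms by (auto simp: m nth_append less_Suc_eq last_conv_nth)
  qed
  ultimately show ?thesis
    using assms by (auto simp: finite_path_def)
qed

lemma paths_to_Suc:
  assumes "n \<ge> 1"
  shows "paths_to B (Suc n) v =
    (\<Union>e\<in>{e \<in> Edge B n. rng B e = v}. (\<lambda>es. es @ [e]) ` paths_to B n (src B e))"
proof (intro set_eqI iffI)
  fix fs assume fs: "fs \<in> paths_to B (Suc n) v"
  then obtain es e where es: "fs = es @ [e]"
    by (cases fs rule: rev_cases) (auto simp: paths_to_def)
  with fs assms have "es \<noteq> []"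
    by (auto simp: paths_to_def)
  thus "fs \<in> (\<Union>e\<in>{e \<in> Edge B n. rng B e = v}. (\<lambda>es. es @ [e]) ` paths_to B n (src B e))"
    using fs by (auto simp: es paths_to_def finite_path_snoc)
next
  fix fs
  assume "fs \<in> (\<Union>e\<in>{e \<in> Edge B n. rng B e = v}. (\<lambda>es. es @ [e]) ` paths_to B n (src B e))"
  then obtain es e where "fs = es @ [e]" "e \<in> Edge B n" "rng B e = v" "es \<in> paths_to B n (src B e)"
    by auto
  moreover from this assms have "es \<noteq> []"
    by (auto simp: paths_to_def)
  ultimately show "fs \<in> paths_to B (Suc n) v"
    by (simp add: paths_to_def finite_path_snoc)
qed

text \<open>A path is determined by its last edge and the path before it. There are
  \<open>r n\<close> choices for the edge, and by induction equally many paths lead to its source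
  whichever edge is chosen. This is the number \<open>R\<^sub>n\<close>.\<close>

lemma finite_card_paths_to:
  assumes "graded_diagram B"
    and card_rng: "\<And>n v. v \<in> Vert B (Suc n) \<Longrightarrow> card {e \<in> Edge B n. rng B e = v} = r n"
    and "n \<ge> 1" "v \<in> Vert B n"
  shows "finite (paths_to B n v) \<and> card (paths_to B n v) = (\<Prod>i<n. r i)"
  using assms(3,4)
proof (induction n arbitrary: v rule: nat_induct_at_least)
  case base
  have "finite {e \<in> Edge B 0. rng B e = v}"
    using assms(1) base by (simp add: graded_diagram_def)
  thus ?case
    using card_rng[of v 0] base by (simp add: paths_to_Suc_0 card_image inj_on_def)
next
  case (Suc n)
  let ?I = "{e \<in> Edge B n. rng B e = v}"
  let ?X = "\<lambda>e. (\<lambda>es. es @ [e]) ` paths_to B n (src B e)"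
  have fin: "finite ?I"
    using assms(1) Suc.prems by (simp add: graded_diagram_def)
  have IH: "finite (paths_to B n (src B e))" "card (paths_to B n (src B e)) = (\<Prod>i<n. r i)"
    if "e \<in> ?I" for e
    using Suc.IH[of "src B e"] assms(1) that by (auto simp: graded_diagram_def)
  have "card (\<Union>e\<in>?I. ?X e) = (\<Sum>e\<in>?I. card (?X e))"
    by (rule card_UN_disjoint) (use fin IH in auto)
  also have "\<dots> = (\<Sum>e\<in>?I. \<Prod>i<n. r i)"
    using IH by (intro sum.cong) (auto simp: card_image inj_on_def)
  also have "\<dots> = (\<Prod>i<Suc n. r i)"
    using card_rng[of v n] Suc.prems by simp
  finally show ?case
    using fin IH Suc.hyps by (simp add: paths_to_Suc)
qed

text \<open>Separate from the count above because in the subdiagram the number of incoming edges may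
  vary within a level.\<close>

lemma paths_to_nonempty:
  assumes "graded_diagram B" "n \<ge> 1" "v \<in> Vert B n"
  shows "paths_to B n v \<noteq> {}"
  using assms(2,3)
proof (induction n arbitrary: v rule: nat_induct_at_least)
  case base
  hence "{e \<in> Edge B 0. rng B e = v} \<noteq> {}"
    using assms(1) by (simp add: graded_diagram_def)
  thus ?case
    by (simp add: paths_to_Suc_0)
next
  case (Suc n)
  hence "{e \<in> Edge B n. rng B e = v} \<noteq> {}"
    using assms(1) by (simp add: graded_diagram_def)
  then obtain e where e: "e \<in> Edge B n" "rng B e = v"
    by blast
  hence "src B e \<in> Vert B n"
    using assms(1) by (simp add: graded_diagram_def)
  hence "paths_to B n (src B e) \<noteq> {}"
    by (rule Suc.IH)
  thus ?case
    using e Suc.hyps by (auto simp: paths_to_Suc)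
qed

section \<open>Topology and Borel sets of the path space\<close>

lemma finite_path_map_upt:
  assumes "x \<in> path_space B"
  shows "finite_path B (map x [0..<Suc n])"
  using assms by (auto simp: finite_path_def path_space_def nth_append simp del: upt_Suc)

lemma topspace_path_topology: "topspace (path_topology B) = path_space B"
proof
  show "path_space B \<subseteq> topspace (path_topology B)"
  proof
    fix x assume "x \<in> path_space B"
    hence "x \<in> cylinder B (map x [0..<Suc 0])" "finite_path B (map x [0..<Suc 0])"
      using finite_path_map_upt[of x B 0] by (auto simp: cylinder_def)
    thus "x \<in> topspace (path_topology B)"
      unfolding path_topology_def topology_generated_by_topspace by blast
  qed
qed (auto simp: path_topology_def cylinder_def)

text \<open>A set decided by the first \<open>n\<close> edges is a union of cylinder sets. Prefixes
  of length \<open>Suc n\<close> cover the case \<open>n = 0\<close>, where the empty list would not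
  be a finite path.\<close>

lemma openin_path_topologyI:
  assumes "U \<subseteq> path_space B"
    and "\<And>x y. x \<in> U \<Longrightarrow> y \<in> path_space B \<Longrightarrow> (\<And>i. i < n \<Longrightarrow> y i = x i) \<Longrightarrow> y \<in> U"
  shows "openin (path_topology B) U"
proof -
  have "U = (\<Union>x\<in>U. cylinder B (map x [0..<Suc n]))"
  proof (intro equalityI subsetI)
    fix x assume "x \<in> U"
    thus "x \<in> (\<Union>x\<in>U. cylinder B (map x [0..<Suc n]))"
      using assms(1) by (auto simp: cylinder_def simp del: upt_Suc intro!: bexI[of _ x])
  next
    fix y assume "y \<in> (\<Union>x\<in>U. cylinder B (map x [0..<Suc n]))"
    then obtain x where "x \<in> U" "y \<in> path_space B" "\<And>i. i < Suc n \<Longrightarrow> y i = x i"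
      by (auto simp: cylinder_def simp del: upt_Suc)
    thus "y \<in> U"
      using assms(2)[of x y] by simp
  qed
  moreover have "openin (path_topology B) (\<Union>x\<in>U. cylinder B (map x [0..<Suc n]))"
    unfolding path_topology_def using assms(1) finite_path_map_upt
    by (intro openin_Union) (blast intro: topology_generated_by_Basis)
  ultimately show ?thesis
    by simp
qed

lemma space_borel_of: "space (borel_of T) = topspace T"
  by (simp add: borel_of_def space_measure_of_conv)

lemma sets_borel_ofI: "openin T U \<Longrightarrow> U \<in> sets (borel_of T)"
  unfolding borel_of_def by (rule in_measure_of) (auto dest: openin_subset)

lemma sets_borel_of_cylinder: "cylinder B es \<in> sets (borel_of (path_topology B))"
  by (intro sets_borel_ofI openin_path_topologyI[where n="length es"]) (auto simp: cylinder_def)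

text \<open>These are the sets in the last clause of \<open>measure_extension\<close>. The prefix
  \<open>es\<close> may run outside the subdiagram; only the later edges are confined to it.\<close>

definition tail_in :: "('v, 'e) bratteli \<Rightarrow> (nat \<Rightarrow> 'v set) \<Rightarrow> 'e list \<Rightarrow> (nat \<Rightarrow> 'e) set" where
  "tail_in B W es = {x \<in> cylinder B es. \<forall>n\<ge>length es. x n \<in> Edge (subdiagram B W) n}"

text \<open>Replacing the prefix by a path of the subdiagram to the same vertex yields a tail
  equivalent path that lies entirely in the subdiagram.\<close>

lemma tail_in_subset_hat_path_space:
  assumes sub: "graded_diagram (subdiagram B W)" and "es \<noteq> []"
  shows "tail_in B W es \<subseteq> hat_path_space B W"
proof
  fix x assume x: "x \<in> tail_in B W es"
  define n where "n = length es"
  have n: "n \<ge> 1"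
    using assms(2) by (cases es) (auto simp: n_def)
  have xB: "x \<in> path_space B" and tail: "\<And>m. m \<ge> n \<Longrightarrow> x m \<in> Edge (subdiagram B W) m"
    using x by (auto simp: tail_in_def cylinder_def n_def)
  have "src B (x n) \<in> Vert (subdiagram B W) n"
    using tail[of n] by (simp add: subdiagram_def)
  then obtain fs where fs: "finite_path (subdiagram B W) fs" "length fs = n"
      "rng B (last fs) = src B (x n)"
    using paths_to_nonempty[OF sub n] by (fastforce simp: paths_to_def subdiagram_def)
  define y where "y i = (if i < n then fs ! i else x i)" for i
  have "y \<in> path_space (subdiagram B W)"
    unfolding path_space_def
  proof safe
    fix i
    show "y i \<in> Edge (subdiagram B W) i"
      using fs tail[of i] by (auto simp: y_def finite_path_def)
    show "rng (subdiagram B W) (y i) = src (subdiagram B W) (y (Suc i))"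
    proof -
      consider "Suc i < n" | "Suc i = n" | "i \<ge> n"
        by linarith
      thus ?thesis
      proof cases
        case 1
        thus ?thesis
          using fs by (auto simp: y_def finite_path_def)
      next
        case 2
        hence "last fs = fs ! i"
          using fs n by (metis One_nat_def diff_Suc_Suc diff_zero finite_path_def last_conv_nth)
        thus ?thesis
          using fs 2 by (auto simp: y_def subdiagram_def)
      next
        case 3
        thus ?thesis
          using xB by (auto simp: y_def path_space_def subdiagram_def)
      qed
    qed
  qed
  moreover have "tail_equivalent x y"
    unfolding tail_equivalent_def y_def by (intro exI[of _ n]) auto
  ultimately show "x \<in> hat_path_space B W"
    using xB by (auto simp: hat_path_space_def)
qed

text \<open>Infinitely many edges are constrained, so the set is written as a countable intersection
  of open sets \<open>U k\<close>, each constraining finitely many. Intersecting with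
  \<open>hat_path_space B W\<close> loses nothing by the preceding lemma.\<close>

lemma sets_tail_in:
  assumes "graded_diagram (subdiagram B W)" "es \<noteq> []"
  shows "tail_in B W es \<in> sets (borel_of (subtopology (path_topology B) (hat_path_space B W)))"
proof -
  define U where "U k = {x \<in> cylinder B es. \<forall>n\<in>{length es..<k}. x n \<in> Edge (subdiagram B W) n}" for k
  have "openin (path_topology B) (U k)" for k
    by (intro openin_path_topologyI[where n="max k (length es)"]) (auto simp: U_def cylinder_def)
  hence "U k \<inter> hat_path_space B W \<in>
      sets (borel_of (subtopology (path_topology B) (hat_path_space B W)))" for k
    by (intro sets_borel_ofI openin_subtopology_Int)
  hence "(\<Inter>k. U k \<inter> hat_path_space B W) \<in>
      sets (borel_of (subtopology (path_topology B) (hat_path_space B W)))"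
    by (intro sets.countable_INT) auto
  moreover have "tail_in B W es = (\<Inter>k. U k \<inter> hat_path_space B W)"
    using tail_in_subset_hat_path_space[OF assms] by (fastforce simp: tail_in_def U_def)
  ultimately show ?thesis
    by simp
qed

subsection \<open>Incidence numbers and masses of cylinder sets\<close>

lemma Vert_subdiagram: "Vert (subdiagram B W) = W"
  by (simp add: subdiagram_def)

lemma rng_subdiagram: "rng (subdiagram B W) = rng B"
  by (simp add: subdiagram_def)

lemma incidence_subdiagram:
  assumes "w \<in> W n" "v \<in> W (Suc n)"
  shows "incidence (subdiagram B W) n v w = incidence B n v w"
  using assms by (auto simp: incidence_def subdiagram_def intro!: arg_cong[where f=card])

lemma finite_edges_into:
  assumes "graded_diagram B" "v \<in> Vert B (Suc n)"
  shows "finite {e \<in> Edge B n. rng B e = v}"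
  using assms by (simp add: graded_diagram_def)

lemma card_edges_into_eq_sum_incidence:
  assumes "graded_diagram B" "v \<in> Vert B (Suc n)" "finite A"
  shows "card {e \<in> Edge B n. rng B e = v \<and> src B e \<in> A} = (\<Sum>w\<in>A. incidence B n v w)"
proof -
  have "{e \<in> Edge B n. rng B e = v \<and> src B e \<in> A} =
      (\<Union>w\<in>A. {e \<in> Edge B n. src B e = w \<and> rng B e = v})"
    by auto
  also have "card \<dots> = (\<Sum>w\<in>A. card {e \<in> Edge B n. src B e = w \<and> rng B e = v})"
  proof (rule card_UN_disjoint)
    show "\<forall>w\<in>A. finite {e \<in> Edge B n. src B e = w \<and> rng B e = v}"
      by (auto intro: finite_subset[OF _ finite_edges_into[OF assms(1,2)]])
  qed (use assms(3) in auto)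
  finally show ?thesis
    by (simp add: incidence_def)
qed

text \<open>Only the finitely many sources of edges into \<open>v\<close> contribute to the infinite
  row sum, so it reduces to a finite sum that counts these edges.\<close>

lemma card_edges_into_eq_row_sum:
  assumes "graded_diagram B" "equal_row_sums B r" "v \<in> Vert B (Suc n)"
  shows "card {e \<in> Edge B n. rng B e = v} = r n"
proof -
  define A where "A = src B ` {e \<in> Edge B n. rng B e = v}"
  have fin: "finite A"
    using finite_edges_into[OF assms(1,3)] by (simp add: A_def)
  have sub: "A \<subseteq> Vert B n"
    using assms(1) by (auto simp: A_def graded_diagram_def)
  have "((\<lambda>w. incidence B n v w) has_sum (\<Sum>w\<in>A. incidence B n v w)) A"
    using fin by (rule has_sum_finite)
  moreover have "incidence B n v w = 0" if "w \<in> Vert B n - A" for w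
  proof -
    have "{e \<in> Edge B n. src B e = w \<and> rng B e = v} = {}"
      using that by (auto simp: A_def)
    thus ?thesis
      by (simp only: incidence_def card.empty)
  qed
  ultimately have "((\<lambda>w. incidence B n v w) has_sum (\<Sum>w\<in>A. incidence B n v w)) (Vert B n)"
    using sub by (subst has_sum_cong_neutral[where T=A]) auto
  moreover have "((\<lambda>w. incidence B n v w) has_sum r n) (Vert B n)"
    using assms(2,3) by (simp add: equal_row_sums_def)
  ultimately have "r n = (\<Sum>w\<in>A. incidence B n v w)"
    by (metis infsumI)
  also have "\<dots> = card {e \<in> Edge B n. rng B e = v \<and> src B e \<in> A}"
    by (rule card_edges_into_eq_sum_incidence[symmetric]) (use assms fin in auto)
  also have "{e \<in> Edge B n. rng B e = v \<and> src B e \<in> A} = {e \<in> Edge B n. rng B e = v}"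
    by (auto simp: A_def)
  finally show ?thesis ..
qed

lemma finite_edges_standard:
  assumes "standard_bratteli G"
  shows "finite (Edge G n)"
proof -
  have "Edge G n = (\<Union>v\<in>Vert G (Suc n). {e \<in> Edge G n. rng G e = v})"
    using assms by (auto simp: standard_bratteli_def graded_diagram_def)
  moreover have "finite (\<Union>v\<in>Vert G (Suc n). {e \<in> Edge G n. rng G e = v})"
    using assms finite_edges_into[of G] by (auto simp: standard_bratteli_def)
  ultimately show ?thesis
    by simp
qed

section \<open>Masses of cylinder sets by terminal vertex\<close>

lemma space_tail_invariant_measure:
  assumes "tail_invariant_measure G M"
  shows "space M = path_space G"
  using assms sets_eq_imp_space_eq[of M]
  by (simp add: tail_invariant_measure_def space_borel_of topspace_path_topology)

text \<open>This is \<open>p\<^sub>n(v)\<close>. The choice of the path is immaterial for tail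
  invariant measures, as the next lemma shows.\<close>

definition cylinder_mass :: "('v, 'e) bratteli \<Rightarrow> (nat \<Rightarrow> 'e) measure \<Rightarrow> nat \<Rightarrow> 'v \<Rightarrow> real" where
  "cylinder_mass G M n v = measure M (cylinder G (SOME es. es \<in> paths_to G n v))"

lemma cylinder_mass_eq:
  assumes "tail_invariant_measure G M" "es \<in> paths_to G n v"
  shows "measure M (cylinder G es) = cylinder_mass G M n v"
proof -
  have "space M = path_space G"
    using assms(1) by (rule space_tail_invariant_measure)
  hence "cylinder G fs \<inter> space M = cylinder G fs" for fs
    by (auto simp: cylinder_def)
  hence "emeasure M (cylinder G es) = emeasure M (cylinder G fs)" if "fs \<in> paths_to G n v" for fs
    using assms that
    by (auto simp: tail_invariant_measure_def tail_invariant_def paths_to_def)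
  moreover have "(SOME es. es \<in> paths_to G n v) \<in> paths_to G n v"
    using assms(2) by (rule someI)
  ultimately show ?thesis
    by (simp add: cylinder_mass_def measure_def)
qed

text \<open>The cylinder set of a path ending at \<open>v\<close> is the disjoint union of the
  cylinder sets of its finitely many one-edge extensions.\<close>

lemma cylinder_mass_rec:
  assumes G: "standard_bratteli G" and M: "tail_invariant_measure G M" "finite_measure M"
    and "n \<ge> 1" "v \<in> Vert G n"
  shows "cylinder_mass G M n v =
    (\<Sum>e | e \<in> Edge G n \<and> src G e = v. cylinder_mass G M (Suc n) (rng G e))"
proof -
  interpret finite_measure M by fact
  let ?I = "{e \<in> Edge G n. src G e = v}"
  obtain es where es: "es \<in> paths_to G n v"
    using paths_to_nonempty[of G n v] assms by (auto simp: standard_bratteli_def)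
  hence len: "length es = n" and "es \<noteq> []"
    using \<open>n \<ge> 1\<close> by (auto simp: paths_to_def)
  have last: "rng G (es ! (n - 1)) = v"
    using es \<open>es \<noteq> []\<close> by (auto simp: paths_to_def last_conv_nth)
  have "cylinder G es = (\<Union>e\<in>?I. cylinder G (es @ [e]))"
  proof (intro set_eqI iffI)
    fix x assume x: "x \<in> cylinder G es"
    hence "x \<in> path_space G" "x (n - 1) = es ! (n - 1)"
      using \<open>n \<ge> 1\<close> by (auto simp: cylinder_def len)
    moreover have "rng G (x (n - 1)) = src G (x (Suc (n - 1)))"
      using \<open>x \<in> path_space G\<close> unfolding path_space_def by blast
    ultimately have "x n \<in> ?I"
      using last \<open>n \<ge> 1\<close> by (auto simp: path_space_def)
    thus "x \<in> (\<Union>e\<in>?I. cylinder G (es @ [e]))"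
      using x by (intro UN_I[of "x n"]) (auto simp: cylinder_def nth_append len less_Suc_eq)
  next
    fix x assume "x \<in> (\<Union>e\<in>?I. cylinder G (es @ [e]))"
    then obtain e where "x \<in> path_space G" "\<And>i. i < Suc n \<Longrightarrow> x i = (es @ [e]) ! i"
      by (auto simp: cylinder_def len)
    thus "x \<in> cylinder G es"
      by (simp add: cylinder_def len nth_append less_Suc_eq)
  qed
  moreover have "measure M (\<Union>e\<in>?I. cylinder G (es @ [e])) =
      (\<Sum>e\<in>?I. measure M (cylinder G (es @ [e])))"
  proof (rule finite_measure_finite_Union)
    show "finite ?I"
      using finite_edges_standard[OF G, of n] by simp
    show "(\<lambda>e. cylinder G (es @ [e])) ` ?I \<subseteq> sets M"
      using M(1) sets_borel_of_cylinder by (auto simp: tail_invariant_measure_def)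
    show "disjoint_family_on (\<lambda>e. cylinder G (es @ [e])) ?I"
      by (auto simp: disjoint_family_on_def cylinder_def)
  qed
  moreover have "measure M (cylinder G (es @ [e])) = cylinder_mass G M (Suc n) (rng G e)"
    if "e \<in> ?I" for e
    by (rule cylinder_mass_eq[OF M(1)]) (use es that \<open>n \<ge> 1\<close> in \<open>auto simp: paths_to_Suc\<close>)
  ultimately show ?thesis
    using cylinder_mass_eq[OF M(1) es] by simp
qed

lemma sum_edges_by_range:
  fixes h :: "'v \<Rightarrow> real"
  assumes "standard_bratteli G"
  shows "(\<Sum>e\<in>Edge G n. h (rng G e)) =
    (\<Sum>v\<in>Vert G (Suc n). real (card {e \<in> Edge G n. rng G e = v}) * h v)"
proof -
  have "(\<Sum>e\<in>Edge G n. h (rng G e)) =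
      (\<Sum>v\<in>Vert G (Suc n). \<Sum>e | e \<in> Edge G n \<and> rng G e = v. h (rng G e))"
    using assms finite_edges_standard[OF assms]
    by (intro sum.group[symmetric]) (auto simp: standard_bratteli_def graded_diagram_def)
  thus ?thesis
    by simp
qed

text \<open>The recursion groups the edges of level \<open>n\<close> by source; regrouping them by
  range turns the coefficients into numbers of incoming edges, which the row sums control.\<close>

lemma sum_cylinder_mass_rec:
  assumes G: "standard_bratteli G" and M: "tail_invariant_measure G M" "finite_measure M"
    and "n \<ge> 1"
  shows "(\<Sum>v\<in>Vert G n. cylinder_mass G M n v) =
    (\<Sum>v\<in>Vert G (Suc n). real (card {e \<in> Edge G n. rng G e = v}) * cylinder_mass G M (Suc n) v)"
proof -
  have "(\<Sum>v\<in>Vert G n. cylinder_mass G M n v) = (\<Sum>v\<in>Vert G n.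
      \<Sum>e | e \<in> Edge G n \<and> src G e = v. cylinder_mass G M (Suc n) (rng G e))"
    using assms by (intro sum.cong refl cylinder_mass_rec)
  also have "\<dots> = (\<Sum>e\<in>Edge G n. cylinder_mass G M (Suc n) (rng G e))"
    using G finite_edges_standard[OF G]
    by (intro sum.group) (auto simp: standard_bratteli_def graded_diagram_def)
  finally show ?thesis
    by (simp add: sum_edges_by_range[OF G])
qed

text \<open>The finitely many cylinder sets of one-edge paths cover the space, so they cannot all be
  null sets.\<close>

lemma sum_cylinder_mass_pos:
  assumes G: "standard_bratteli G" and M: "tail_invariant_measure G M" "prob_space M"
  shows "(\<Sum>v\<in>Vert G 1. cylinder_mass G M 1 v) > 0"
proof (rule ccontr)
  interpret prob_space M by fact
  have nonneg: "cylinder_mass G M n v \<ge> 0" for n v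
    by (simp add: cylinder_mass_def)
  assume "\<not> ?thesis"
  hence "(\<Sum>v\<in>Vert G 1. cylinder_mass G M 1 v) = 0"
    using sum_nonneg[of "Vert G 1" "cylinder_mass G M 1"] nonneg by fastforce
  hence zero: "cylinder_mass G M 1 v = 0" if "v \<in> Vert G 1" for v
    using that G nonneg by (subst (asm) sum_nonneg_eq_0_iff) (auto simp: standard_bratteli_def)
  have "space M = path_space G"
    using M(1) by (rule space_tail_invariant_measure)
  hence "space M = (\<Union>e\<in>Edge G 0. cylinder G [e])"
    by (auto simp: cylinder_def path_space_def)
  moreover have "measure M (\<Union>e\<in>Edge G 0. cylinder G [e]) \<le> (\<Sum>e\<in>Edge G 0. measure M (cylinder G [e]))"
    using M(1) sets_borel_of_cylinder finite_edges_standard[OF G]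
    by (intro finite_measure_subadditive_finite) (auto simp: tail_invariant_measure_def)
  moreover have "measure M (cylinder G [e]) = 0" if "e \<in> Edge G 0" for e
  proof -
    have "rng G e \<in> Vert G 1"
      using that G by (simp add: standard_bratteli_def graded_diagram_def)
    moreover have "measure M (cylinder G [e]) = cylinder_mass G M 1 (rng G e)"
      by (intro cylinder_mass_eq M(1)) (use that in \<open>simp add: paths_to_Suc_0\<close>)
    ultimately show ?thesis
      using zero by simp
  qed
  ultimately show False
    using prob_space by simp
qed

text \<open>Each of the \<open>R\<^sub>n\<close> paths of \<open>B\<close> to a vertex
  \<open>v\<close> of \<open>W n\<close> gives a set \<open>tail_in B W es\<close> of extended
  measure \<open>p\<^sub>n(v)\<close>, and these sets are disjoint parts of the extended path
  space.\<close>

lemma prod_mult_sum_cylinder_mass_le: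
  assumes B: "graded_diagram B"
    and card_rng: "\<And>n v. v \<in> Vert B (Suc n) \<Longrightarrow> card {e \<in> Edge B n. rng B e = v} = r n"
    and W: "\<And>n. W n \<subseteq> Vert B n"
    and G: "standard_bratteli (subdiagram B W)"
    and M: "tail_invariant_measure (subdiagram B W) M" "finite_measure M"
    and ext: "measure_extension B W M N"
    and fin: "emeasure N (hat_path_space B W) < \<infinity>"
    and n: "n \<ge> 1"
  shows "(\<Prod>i<n. real (r i)) * (\<Sum>v\<in>W n. cylinder_mass (subdiagram B W) M n v)
    \<le> measure N (hat_path_space B W)"
proof -
  interpret finite_measure M by fact
  let ?G = "subdiagram B W"
  have sub: "graded_diagram ?G" and finW: "finite (W n)"
    using G by (auto simp: standard_bratteli_def subdiagram_def)
  have setsN: "sets N = sets (borel_of (subtopology (path_topology B) (hat_path_space B W)))"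
    using ext by (simp add: measure_extension_def)
  have spaceN: "space N = hat_path_space B W"
    using sets_eq_imp_space_eq[OF setsN]
    by (auto simp: space_borel_of topspace_path_topology hat_path_space_def)
  interpret N: finite_measure N
    using fin by (intro finite_measureI) (simp add: spaceN)
  have paths: "finite (paths_to B n v)" "card (paths_to B n v) = (\<Prod>i<n. r i)" if "v \<in> W n" for v
    using finite_card_paths_to[OF B card_rng n, of v] W[of n] that by auto
  have mass: "measure N (tail_in B W es) = cylinder_mass ?G M n v"
    if v: "v \<in> W n" "es \<in> paths_to B n v" for v es
  proof -
    obtain fs where "fs \<in> paths_to ?G n v"
      using paths_to_nonempty[OF sub n, of v] v by (auto simp: Vert_subdiagram)
    hence fs: "finite_path ?G fs" "rng B (last fs) = v"
        and mass_fs: "measure M (cylinder ?G fs) = cylinder_mass ?G M n v"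
      using cylinder_mass_eq[OF M(1)] by (simp_all add: paths_to_def rng_subdiagram)
    have "finite_path B es" "rng B (last es) = v"
      using v by (simp_all add: paths_to_def)
    with ext fs have "emeasure N (tail_in B W es) = emeasure M (cylinder ?G fs)"
      unfolding measure_extension_def tail_in_def by blast
    with mass_fs show ?thesis
      by (simp only: measure_def)
  qed
  define I where "I = (\<Union>v\<in>W n. paths_to B n v)"
  have "finite I"
    using finW paths by (simp add: I_def)
  have I: "length es = n" "es \<noteq> []" if "es \<in> I" for es
    using that n by (auto simp: I_def paths_to_def)
  have "(\<Prod>i<n. real (r i)) * (\<Sum>v\<in>W n. cylinder_mass ?G M n v) =
      (\<Sum>v\<in>W n. \<Sum>es\<in>paths_to B n v. measure N (tail_in B W es))"
    using mass paths by (simp add: sum_distrib_left)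
  also have "\<dots> = (\<Sum>es\<in>I. measure N (tail_in B W es))"
    unfolding I_def
    by (rule sum.UNION_disjoint[symmetric]) (use finW paths in \<open>auto simp: paths_to_def\<close>)
  also have "\<dots> = measure N (\<Union>es\<in>I. tail_in B W es)"
  proof (rule N.finite_measure_finite_Union[symmetric])
    show "tail_in B W ` I \<subseteq> sets N"
      using sets_tail_in[OF sub] I by (auto simp: setsN)
    \<comment> \<open>All paths in \<open>I\<close> have length \<open>n\<close>, so two of them
      that are prefixes of the same infinite path coincide.\<close>
    show "disjoint_family_on (tail_in B W) I"
      unfolding disjoint_family_on_def
    proof safe
      fix es fs x
      assume "es \<in> I" "fs \<in> I" "es \<noteq> fs" "x \<in> tail_in B W es" "x \<in> tail_in B W fs"
      hence "es = fs"
        using I by (intro nth_equalityI) (auto simp: tail_in_def cylinder_def)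
      with \<open>es \<noteq> fs\<close> show "x \<in> {}"
        by simp
    qed
  qed fact
  also have "\<dots> \<le> measure N (hat_path_space B W)"
    by (metis N.bounded_measure spaceN)
  finally show ?thesis .
qed

section \<open>Edges entering the subdiagram from outside\<close>

lemma finite_Wprime:
  assumes "graded_diagram B" "W (Suc n) \<subseteq> Vert B (Suc n)" "finite (W (Suc n))"
  shows "finite (Wprime B W n)"
proof (rule finite_subset)
  \<comment> \<open>Although level \<open>n\<close> of \<open>B\<close> is infinite, only finitely
    many edges enter the finite set \<open>W (Suc n)\<close>. This finiteness is what makes the
    \<open>Max\<close> and \<open>Min\<close> over \<open>Wprime B W n\<close> usable as
    bounds.\<close>
  show "Wprime B W n \<subseteq> src B ` (\<Union>v\<in>W (Suc n). {e \<in> Edge B n. rng B e = v})"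
  proof
    fix w assume "w \<in> Wprime B W n"
    then obtain v where v: "v \<in> W (Suc n)" "incidence B n v w > 0"
      by (auto simp: Wprime_def)
    hence "{e \<in> Edge B n. src B e = w \<and> rng B e = v} \<noteq> {}"
      by (metis card.empty incidence_def less_irrefl)
    thus "w \<in> src B ` (\<Union>v\<in>W (Suc n). {e \<in> Edge B n. rng B e = v})"
      using v by auto
  qed
  show "finite (src B ` (\<Union>v\<in>W (Suc n). {e \<in> Edge B n. rng B e = v}))"
    using assms finite_edges_into[OF assms(1)] by (intro finite_imageI finite_UN_I) auto
qed

text \<open>The source of an edge into \<open>v\<close> that is not in \<open>W n\<close> belongs to
  \<open>Wprime B W n\<close>, the edge itself being the witness.\<close>

lemma row_sum_split:
  assumes B: "graded_diagram B" and "W n \<subseteq> Vert B n" "W (Suc n) \<subseteq> Vert B (Suc n)"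
    and fin: "finite (W n)" "finite (W (Suc n))" and v: "v \<in> W (Suc n)"
  shows "card {e \<in> Edge B n. rng B e = v} =
    (\<Sum>w\<in>W n. incidence B n v w) + (\<Sum>w\<in>Wprime B W n. incidence B n v w)"
proof -
  have v': "v \<in> Vert B (Suc n)"
    using assms by auto
  have "{e \<in> Edge B n. rng B e = v} =
      {e \<in> Edge B n. rng B e = v \<and> src B e \<in> W n \<union> Wprime B W n}"
  proof -
    have "src B e \<in> Wprime B W n" if e: "e \<in> Edge B n" "rng B e = v" "src B e \<notin> W n" for e
    proof -
      have "incidence B n v (src B e) > 0"
        unfolding incidence_def using e
        by (subst card_gt_0_iff) (auto intro: finite_subset[OF _ finite_edges_into[OF B v']])
      thus ?thesis
        using e v B by (auto simp: Wprime_def graded_diagram_def)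
    qed
    thus ?thesis
      by auto
  qed
  also have "card \<dots> = (\<Sum>w\<in>W n \<union> Wprime B W n. incidence B n v w)"
    by (rule card_edges_into_eq_sum_incidence)
       (use B v' fin finite_Wprime[of B W n] assms in auto)
  also have "\<dots> = (\<Sum>w\<in>W n. incidence B n v w) + (\<Sum>w\<in>Wprime B W n. incidence B n v w)"
    by (rule sum.union_disjoint) (use assms finite_Wprime[of B W n] in \<open>auto simp: Wprime_def\<close>)
  finally show ?thesis .
qed

theorem theorem4p5:
  fixes B :: "('v, 'e) bratteli"
    and r :: "nat \<Rightarrow> nat"
    and W :: "nat \<Rightarrow> 'v set"
    and \<nu> \<nu>hat :: "(nat \<Rightarrow> 'e) measure"
    and \<delta> :: real
  assumes "generalized_bratteli B"
    and "equal_row_sums B r"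
    and "\<And>n. W n \<subset> Vert B n"
    and "standard_bratteli (subdiagram B W)"
    and "simple_bratteli (subdiagram B W)"
    and "tail_invariant_measure (subdiagram B W) \<nu>"
    and "prob_space \<nu>"
    and "measure_extension B W \<nu> \<nu>hat"
    and "emeasure \<nu>hat (hat_path_space B W) < \<infinity>"
    and "\<And>n. n \<ge> 1 \<Longrightarrow> Wprime B W n \<noteq> {}"
    and "\<delta> > 0"
    and "\<And>n. n \<ge> 1 \<Longrightarrow> real (mprime B W n) / real (Mprime B W n) \<ge> \<delta>"
  shows "convergent (\<lambda>n. \<Prod>i\<le>n. real (r i) / (real (Mbar B W i) * real (card (W i))))"
proof -
  interpret prob_space \<nu> by fact
  let ?G = "subdiagram B W"
  have B: "graded_diagram B"
    using assms(1) by (simp add: generalized_bratteli_def)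
  have W: "W n \<subseteq> Vert B n" for n
    using assms(3)[of n] by blast
  have finW: "finite (W n)" and neW: "W n \<noteq> {}" for n
    using assms(4) by (auto simp: standard_bratteli_def subdiagram_def)
  have finW': "finite (Wprime B W n)" for n
    using finite_Wprime[of B W n] B W finW by blast
  have card_rng: "card {e \<in> Edge B n. rng B e = v} = r n" if "v \<in> Vert B (Suc n)" for n v
    using card_edges_into_eq_row_sum[OF B assms(2) that] .
  \<comment> \<open>The incoming edges of a vertex of the subdiagram are counted separately:
    \<open>d\<close> for those from \<open>W n\<close>, \<open>d'\<close> for those from
    outside.\<close>
  define d where "d n v = (\<Sum>w\<in>W n. incidence B n v w)" for n v
  define d' where "d' n v = (\<Sum>w\<in>Wprime B W n. incidence B n v w)" for n v
  have split: "r n = d n v + d' n v" if "v \<in> W (Suc n)" for n v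
    using row_sum_split[of B W n v] that B W[of n] W[of "Suc n"] finW card_rng[of v n]
    by (simp add: d_def d'_def subset_iff)
  have d_card: "card {e \<in> Edge ?G n. rng ?G e = v} = d n v" if v: "v \<in> W (Suc n)" for n v
  proof -
    have "{e \<in> Edge ?G n. rng ?G e = v} = {e \<in> Edge B n. rng B e = v \<and> src B e \<in> W n}"
      using v by (auto simp: subdiagram_def)
    also have "card \<dots> = d n v"
      unfolding d_def using B W finW v by (intro card_edges_into_eq_sum_incidence) auto
    finally show ?thesis .
  qed
  have d_le: "d n v \<le> Mbar B W n * card (W n)" if v: "v \<in> W (Suc n)" for n v
  proof -
    have "incidence B n v w \<le> Mbar B W n" if "w \<in> W n" for w
      unfolding Mbar_def using that v finW by (intro Max_ge finite_image_set2) auto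
    thus ?thesis
      using sum_bounded_above[of "W n" "incidence B n v" "Mbar B W n"]
      by (simp add: d_def mult.commute)
  qed
  \<comment> \<open>At level 0 the set \<open>Wprime B W n\<close> may be empty; then both sides are
    0, whatever the value of \<open>Max\<close> on the empty set.\<close>
  have d'_le: "d' n v \<le> Mprime B W n * card (Wprime B W n)" if v: "v \<in> W (Suc n)" for n v
  proof -
    have "incidence B n v w \<le> Mprime B W n" if "w \<in> Wprime B W n" for w
      unfolding Mprime_def using that v finW finW' by (intro Max_ge finite_image_set2) auto
    thus ?thesis
      using sum_bounded_above[of "Wprime B W n" "incidence B n v" "Mprime B W n"]
      by (simp add: d'_def mult.commute)
  qed
  have d'_ge: "mprime B W n * card (Wprime B W n) \<le> d' n v" if v: "v \<in> W (Suc n)" for n v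
  proof -
    have "mprime B W n \<le> incidence B n v w" if "w \<in> Wprime B W n" for w
      unfolding mprime_def using that v finW finW' by (intro Min_le finite_image_set2) auto
    thus ?thesis
      using sum_bounded_below[of "Wprime B W n" "mprime B W n" "incidence B n v"]
      by (simp add: d'_def mult.commute)
  qed
  define K where "K n = real (Mbar B W n) * real (card (W n))" for n
  define l where "l n = real (mprime B W n) * real (card (Wprime B W n))" for n
  define u where "u n = real (Mprime B W n) * real (card (Wprime B W n))" for n
  define S where "S n = (\<Sum>v\<in>W n. cylinder_mass ?G \<nu> n v)" for n
  \<comment> \<open>Simplicity enters here; it makes both \<open>r n\<close> and the denominator
    \<open>K n\<close> positive.\<close>
  have d_pos: "d n v > 0" if v: "v \<in> W (Suc n)" for n v
  proof -
    have "incidence B n v w > 0" if "w \<in> W n" for w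
      using assms(5) that v incidence_subdiagram[OF that v, of B]
      by (fastforce simp: simple_bratteli_def Vert_subdiagram)
    thus ?thesis
      unfolding d_def using finW neW by (intro sum_pos)
  qed
  have vertex: "\<exists>v. v \<in> W (Suc n)" for n
    using neW[of "Suc n"] by blast
  have "convergent (\<lambda>n. \<Prod>i\<le>n. real (r i) / K i)"
  proof (rule convergent_prod_ratio)
    show "real (r n) > 0" for n
      using vertex[of n] split[of _ n] d_pos[of _ n] by fastforce
    show "K n > 0" for n
    proof -
      obtain v where "v \<in> W (Suc n)"
        using vertex by blast
      hence "0 < Mbar B W n * card (W n)"
        using d_pos[of v n] d_le[of v n] by linarith
      thus ?thesis
        unfolding K_def by (simp only: of_nat_0_less_iff flip: of_nat_mult)
    qed
    show "S 1 > 0"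
      using sum_cylinder_mass_pos[OF assms(4,6,7)] by (simp add: S_def subdiagram_def)
    show "S n \<le> (real (r n) - l n) * S (Suc n)" if n: "n \<ge> 1" for n
    proof -
      have "S n = (\<Sum>v\<in>W (Suc n). real (d n v) * cylinder_mass ?G \<nu> (Suc n) v)"
        using sum_cylinder_mass_rec[OF assms(4,6) finite_measure_axioms n] d_card
        by (simp add: S_def subdiagram_def)
      also have "\<dots> \<le> (\<Sum>v\<in>W (Suc n). (real (r n) - l n) * cylinder_mass ?G \<nu> (Suc n) v)"
      proof (intro sum_mono mult_right_mono)
        fix v assume v: "v \<in> W (Suc n)"
        have "l n \<le> real (d' n v)"
          using d'_ge[OF v] unfolding l_def by (simp only: of_nat_le_iff flip: of_nat_mult)
        thus "real (d n v) \<le> real (r n) - l n"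
          using split[OF v] by simp
      qed (simp add: cylinder_mass_def)
      finally show ?thesis
        by (simp add: S_def sum_distrib_left)
    qed
    \<comment> \<open>Finiteness of the extension enters here: the bound \<open>C\<close> is its
      total mass.\<close>
    show "(\<Prod>i<n. real (r i)) * S n \<le> measure \<nu>hat (hat_path_space B W)" if "n \<ge> 1" for n
      unfolding S_def
      using prod_mult_sum_cylinder_mass_le[OF B card_rng W assms(4,6) finite_measure_axioms
          assms(8,9) that] by blast
    show "real (r n) - u n \<le> K n" for n
    proof -
      obtain v where v: "v \<in> W (Suc n)"
        using vertex by blast
      have "r n \<le> Mbar B W n * card (W n) + Mprime B W n * card (Wprime B W n)"
        using split[OF v] d_le[OF v] d'_le[OF v] by simp
      hence "real (r n) \<le> K n + u n"
        unfolding K_def u_def by (simp only: of_nat_le_iff flip: of_nat_mult of_nat_add)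
      thus ?thesis
        by simp
    qed
    show "\<delta> * u n \<le> l n" if n: "n \<ge> 1" for n
    proof -
      \<comment> \<open>With denominator 0 the quotient would be 0 by convention, against the
        positive lower bound \<open>\<delta>\<close>.\<close>
      have "Mprime B W n \<noteq> 0"
        using assms(12)[OF n] \<open>\<delta> > 0\<close> by (metis div_by_0 not_le of_nat_0)
      hence "\<delta> * real (Mprime B W n) \<le> real (mprime B W n)"
        using assms(12)[OF n] by (subst (asm) pos_le_divide_eq) auto
      thus ?thesis
        unfolding u_def l_def mult.assoc[symmetric] by (rule mult_right_mono) simp
    qed
  qed (auto simp: l_def u_def S_def cylinder_mass_def intro!: sum_nonneg assms(11))
  thus ?thesis
    by (simp add: K_def)
qed

end
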